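(* For every integer $n > 3$, $A_{\text{no4c}}(n) \leq n-2$.
   Context: For a finite set $\mathcal P \subset \mathbb{R}^2$, $A(\mathcal P)$ denotes the number of distinct values in the open interval $(0,\pi)$ of angles $\angle pqr$ with $p,q,r$ distinct points of $\mathcal P$ (angles of $0$ and $\pi$ are not counted). $A_{\text{no4c}}(n)$ is the minimum of $A(\mathcal P)$ over all sets $\mathcal P \subset \mathbb{R}^2$ of $n$ points, not all collinear, such that no four points of $\mathcal P$ lie on a common circle. *)

theory Defs
  imports "HOL-Analysis.Analysis" "HOL-Library.Extended_Nat"
begin

(* The unoriented angle at q, with values in [0, pi]; meaningful for p and r different from q. *)
definition angle :: "real^2 \<Rightarrow> real^2 \<Rightarrow> real^2 \<Rightarrow> real" where
  "angle p q r = arccos (((p - q) \<bullet> (r - q)) / (norm (p - q) * norm (r - q)))"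

definition angles :: "(real^2) set \<Rightarrow> real set" where
  "angles P = {angle p q r | p q r.
     p \<in> P \<and> q \<in> P \<and> r \<in> P \<and> p \<noteq> q \<and> q \<noteq> r \<and> p \<noteq> r}"

definition num_angles :: "(real^2) set \<Rightarrow> nat" where
  "num_angles P = card (angles P \<inter> {0<..<pi})"

definition concyclic :: "(real^2) set \<Rightarrow> bool" where
  "concyclic S \<longleftrightarrow> (\<exists>c r. r > 0 \<and> S \<subseteq> sphere c r)"

definition no_four_concyclic :: "(real^2) set \<Rightarrow> bool" where
  "no_four_concyclic P \<longleftrightarrow> \<not> (\<exists>S\<subseteq>P. card S = 4 \<and> concyclic S)"

definition no4c_configs :: "nat \<Rightarrow> (real^2) set set" where
  "no4c_configs n = {P. finite P \<and> card P = n \<and> \<not> collinear P \<and> no_four_concyclic P}"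

(* The infimum of a nonempty set of extended naturals is attained, so this is the minimum.
   It is taken in enat, where the infimum of the empty set is infinite, so that an upper
   bound on A_no4c n also asserts that an admissible configuration of n points exists. *)
definition A_no4c :: "nat \<Rightarrow> enat" where
  "A_no4c n = (INF P\<in>no4c_configs n. enat (num_angles P))"

end

theory Submission imports Defs begin

text \<open>
  Take the origin together with the \<open>n - 1\<close> points of the line \<open>y = 1\<close> that are seen from the
  origin in the directions \<open>k \<pi> / n\<close>, \<open>0 < k < n\<close>; these are the vertices of a regular
  \<open>n\<close>-gon projected from one of them onto a line. A nondegenerate triangle
  of this set has the origin as a vertex, and all its angles are positive multiples of \<open>\<pi> / n\<close>
  with sum \<open>\<pi>\<close>, so each of them is at most \<open>(n - 2) \<pi> / n\<close>. A circle meets the line in at most two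
  points, so it contains at most three points of the set.
\<close>

section \<open>Triangles with the origin as apex and base on the line y = 1\<close>

lemma angle_eqI:
  assumes "p \<noteq> q" "r \<noteq> q" "0 \<le> t" "t \<le> pi"
    and "(p - q) \<bullet> (r - q) = norm (p - q) * norm (r - q) * cos t"
  shows "angle p q r = t"
  using assms by (simp add: angle_def arccos_cos)

lemma angle_commute: "angle p q r = angle r q p"
  by (simp add: angle_def inner_commute mult.commute)

text \<open>The index is the polar angle rather than the abscissa, so that the angles of the
  triangles are linear in the indices. As \<open>t\<close> grows from 0 to \<open>pi\<close>, the
  point moves from right to left.\<close>

definition line_point :: "real \<Rightarrow> real^2" where
  "line_point t = vector [cot t, 1]"

lemma line_point_nth [simp]: "line_point t $ 1 = cot t" "line_point t $ 2 = 1"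
  by (simp_all add: line_point_def)

lemma line_point_nonzero [simp]: "line_point t \<noteq> 0"
  by (metis line_point_nth(2) zero_index zero_neq_one)

lemma norm_line_point:
  assumes "0 < t" "t < pi"
  shows "norm (line_point t) = 1 / sin t"
proof -
  have s: "sin t > 0" using assms by (simp add: sin_gt_zero)
  have "(cot t)\<^sup>2 + 1 = (1 / sin t)\<^sup>2"
    using s sin_cos_squared_add[of t]
    by (simp add: cot_def power_divide field_simps)
  then show ?thesis
    using s by (simp add: norm_vec_def L2_set_def sum_2)
qed

text \<open>The difference \<open>cot s - cot t\<close> equals
  \<open>sin (t - s) / (sin s * sin t)\<close>, and all three sines are positive.\<close>

lemma cot_strict_antimono:
  assumes "0 < s" "s < t" "t < pi"
  shows "cot t < cot s"
proof -
  have "sin s > 0" "sin t > 0" "sin (t - s) > 0" using assms by (auto intro!: sin_gt_zero)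
  then show ?thesis by (simp add: cot_def sin_diff field_simps)
qed

lemma inj_on_line_point: "inj_on line_point {0<..<pi}"
proof (rule inj_onI)
  fix s t assume st: "s \<in> {0<..<pi}" "t \<in> {0<..<pi}" "line_point s = line_point t"
  then have "cot s = cot t" by (metis line_point_nth(1))
  with st show "s = t"
    by (metis cot_strict_antimono greaterThanLessThan_iff less_irrefl linorder_neqE_linordered_idom)
qed

text \<open>Multiplied by \<open>sin s\<close> and \<open>sin t\<close>, the two points become the
  unit vectors with polar angles \<open>s\<close> and \<open>t\<close>, so the cosine identity is
  the subtraction formula.\<close>

lemma angle_at_origin:
  assumes "0 < s" "s < t" "t < pi"
  shows "angle (line_point s) 0 (line_point t) = t - s"
proof (rule angle_eqI)
  have "sin s > 0" "sin t > 0" using assms by (auto intro!: sin_gt_zero)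
  then show "(line_point s - 0) \<bullet> (line_point t - 0)
      = norm (line_point s - 0) * norm (line_point t - 0) * cos (t - s)"
    using assms
    by (simp add: norm_line_point inner_vec_def sum_2 cot_def cos_diff field_simps)
qed (use assms in auto)

lemma line_point_diff_inner:
  "(0 - line_point s) \<bullet> (line_point t - line_point s) = cot s * (cot s - cot t)"
  by (simp add: inner_vec_def sum_2 algebra_simps)

lemma norm_line_point_diff: "norm (line_point t - line_point s) = \<bar>cot t - cot s\<bar>"
  by (simp add: norm_vec_def L2_set_def sum_2)

text \<open>From \<open>line_point t\<close> the other base point is seen to the right, in direction
  0, and the origin in direction \<open>t - pi\<close>.\<close>

lemma angle_at_left_end:
  assumes "0 < s" "s < t" "t < pi"
  shows "angle 0 (line_point t) (line_point s) = pi - t"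
proof (rule angle_eqI)
  have c: "cot t < cot s" by (rule cot_strict_antimono[OF assms])
  then show "line_point s \<noteq> line_point t" by (metis less_irrefl line_point_nth(1))
  \<comment> \<open>Expanding at \<open>t\<close> alone suffices: \<open>cot s\<close> occurs only
    in the factor \<open>cot s - cot t\<close>, which both sides share up to sign.\<close>
  have cot_t: "cot t = cos t / sin t" by (simp add: cot_def)
  have "sin t > 0" using assms by (auto intro!: sin_gt_zero)
  then show "(0 - line_point t) \<bullet> (line_point s - line_point t)
      = norm (0 - line_point t) * norm (line_point s - line_point t) * cos (pi - t)"
    unfolding line_point_diff_inner norm_line_point_diff
    using assms c by (simp add: norm_line_point cot_t field_simps)
qed (use assms in \<open>auto simp: eq_commute[of 0]\<close>)

text \<open>From \<open>line_point s\<close> the other base point is seen to the left, in direction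
  \<open>pi\<close>, and the origin in direction \<open>pi + s\<close>.\<close>

lemma angle_at_right_end:
  assumes "0 < s" "s < t" "t < pi"
  shows "angle 0 (line_point s) (line_point t) = s"
proof (rule angle_eqI)
  have c: "cot t < cot s" by (rule cot_strict_antimono[OF assms])
  then show "line_point t \<noteq> line_point s" by (metis less_irrefl line_point_nth(1))
  have cot_s: "cot s = cos s / sin s" by (simp add: cot_def)
  have "sin s > 0" using assms by (auto intro!: sin_gt_zero)
  then show "(0 - line_point s) \<bullet> (line_point t - line_point s)
      = norm (0 - line_point s) * norm (line_point t - line_point s) * cos s"
    unfolding line_point_diff_inner norm_line_point_diff
    using assms c by (simp add: norm_line_point cot_s field_simps)
qed (use assms in \<open>auto simp: eq_commute[of 0]\<close>)

text \<open>The cosine is the product of the signs of two nonzero differences of abscissas. Such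
  triples thus contribute only values that the count excludes.\<close>

lemma angle_on_line:
  assumes "line_point s \<noteq> line_point t" "line_point u \<noteq> line_point t"
  shows "angle (line_point s) (line_point t) (line_point u) \<in> {0, pi}"
proof -
  define a b where "a = cot s - cot t" and "b = cot u - cot t"
  have "a \<noteq> 0" "b \<noteq> 0"
    using assms by (auto simp: a_def b_def line_point_def)
  moreover have "angle (line_point s) (line_point t) (line_point u) = arccos (a * b / (\<bar>a\<bar> * \<bar>b\<bar>))"
    unfolding angle_def norm_line_point_diff
    by (simp add: inner_vec_def sum_2 a_def b_def)
  moreover have "a * b / (\<bar>a\<bar> * \<bar>b\<bar>) \<in> {1, -1}"
    using \<open>a \<noteq> 0\<close> \<open>b \<noteq> 0\<close> by (auto simp: abs_if)
  ultimately show ?thesis by (metis arccos_1 arccos_minus_1 insert_iff singletonD)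
qed

section \<open>The fan and its angles\<close>

definition fan :: "nat \<Rightarrow> (real^2) set" where
  "fan n = insert 0 ((\<lambda>k. line_point (real k * pi / real n)) ` {1..<n})"

lemma fan_angle_bounds:
  assumes "k \<in> {1..<n}"
  shows "0 < real k * pi / real n" "real k * pi / real n < pi"
  using assms by (auto simp: field_simps)

lemma fan_angle_less:
  assumes "j < k" "k < (n::nat)"
  shows "real j * pi / real n < real k * pi / real n"
  using assms by (simp add: divide_strict_right_mono)

lemma inj_on_fan: "inj_on (\<lambda>k. line_point (real k * pi / real n)) {1..<n}"
proof (rule inj_onI)
  fix j k assume jk: "j \<in> {1..<n}" "k \<in> {1..<n}"
    and "line_point (real j * pi / real n) = line_point (real k * pi / real n)"
  then have "real j * pi / real n = real k * pi / real n"
    using fan_angle_bounds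
    by (intro inj_onD[OF inj_on_line_point]) (simp_all only: greaterThanLessThan_iff simp_thms)
  with jk show "j = k" by simp
qed

lemma card_fan: "n > 0 \<Longrightarrow> card (fan n) = n"
  by (subst fan_def, subst card_insert_disjoint)
    (auto simp: card_image[OF inj_on_fan] eq_commute[of 0] simp del: One_nat_def)

lemma finite_fan: "finite (fan n)"
  by (simp add: fan_def)

text \<open>Two distinct indices between 1 and \<open>n - 1\<close> differ by at least 1 and at most
  \<open>n - 2\<close>.\<close>

lemma angle_apex_fan:
  assumes "i \<in> {1..<n}" "k \<in> {1..<n}" "i \<noteq> k"
  shows "angle (line_point (real i * pi / real n)) 0 (line_point (real k * pi / real n))
    \<in> (\<lambda>m. real m * pi / real n) ` {1..n - 2}"
  using assms
proof (induction i k rule: linorder_wlog)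
  case (le i k)
  then have "i < k" by simp
  then have "angle (line_point (real i * pi / real n)) 0 (line_point (real k * pi / real n)) = real k * pi / real n - real i * pi / real n"
    using le fan_angle_less fan_angle_bounds by (intro angle_at_origin) auto
  also have "\<dots> = real (k - i) * pi / real n"
    using le by (simp add: of_nat_diff left_diff_distrib diff_divide_distrib)
  finally show ?case using le by (intro image_eqI[of _ _ "k - i"]) auto
next
  case (sym i k)
  then show ?case by (metis angle_commute)
qed

text \<open>If \<open>i < k\<close>, the multiple is \<open>i\<close>, and
  \<open>k \<le> n - 1\<close> keeps it at most \<open>n - 2\<close>. If \<open>k < i\<close>, it is
  \<open>n - i\<close>, and \<open>k \<ge> 1\<close> forces \<open>i \<ge> 2\<close>. The second
  base point is what rules out the multiple \<open>n - 1\<close>.\<close>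

lemma angle_base_fan:
  assumes "i \<in> {1..<n}" "k \<in> {1..<n}" "i \<noteq> k"
  shows "angle 0 (line_point (real i * pi / real n)) (line_point (real k * pi / real n))
    \<in> (\<lambda>m. real m * pi / real n) ` {1..n - 2}"
proof (cases "i < k")
  case True
  then have "angle 0 (line_point (real i * pi / real n)) (line_point (real k * pi / real n)) = real i * pi / real n"
    using assms fan_angle_less fan_angle_bounds by (intro angle_at_right_end) auto
  then show ?thesis using True assms by (intro image_eqI[of _ _ i]) auto
next
  case False
  then have "k < i" using assms by simp
  then have "angle 0 (line_point (real i * pi / real n)) (line_point (real k * pi / real n)) = pi - real i * pi / real n"
    using assms fan_angle_less fan_angle_bounds by (intro angle_at_left_end) auto
  also have "\<dots> = real (n - i) * pi / real n"
    using assms by (simp add: of_nat_diff field_simps)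
  finally show ?thesis using \<open>k < i\<close> assms by (intro image_eqI[of _ _ "n - i"]) auto
qed

lemma angles_fan: "angles (fan n) \<inter> {0<..<pi} \<subseteq> (\<lambda>m. real m * pi / real n) ` {1..n - 2}"
proof
  let ?q = "\<lambda>k. line_point (real k * pi / real n)"
  fix a assume a: "a \<in> angles (fan n) \<inter> {0<..<pi}"
  then obtain p q r where pqr: "p \<in> fan n" "q \<in> fan n" "r \<in> fan n"
      "p \<noteq> q" "q \<noteq> r" "p \<noteq> r" "a = angle p q r"
    by (auto simp: angles_def)
  have split: "x = 0 \<or> (\<exists>k\<in>{1..<n}. x = ?q k)" if "x \<in> fan n" for x
    using that by (auto simp: fan_def)
  \<comment> \<open>By distinctness the origin occurs at most once among \<open>p\<close>,
    \<open>q\<close>, \<open>r\<close>. Its position decides between an apex angle, a base angle (in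
    either orientation) and a degenerate triple.\<close>
  consider (apex) "q = 0" | (left) "q \<noteq> 0" "p = 0" | (right) "q \<noteq> 0" "r = 0"
    | (line) "p \<noteq> 0" "q \<noteq> 0" "r \<noteq> 0" by blast
  then show "a \<in> (\<lambda>m. real m * pi / real n) ` {1..n - 2}"
  proof cases
    case apex
    then obtain i k where ik: "i \<in> {1..<n}" "k \<in> {1..<n}" "p = ?q i" "r = ?q k"
      using split pqr by metis
    then have "i \<noteq> k" using pqr by auto
    then show ?thesis using angle_apex_fan ik apex pqr by metis
  next
    case left
    then obtain i k where ik: "i \<in> {1..<n}" "k \<in> {1..<n}" "q = ?q i" "r = ?q k"
      using split pqr by metis
    then have "i \<noteq> k" using pqr by auto
    then show ?thesis using angle_base_fan ik left pqr by metis
  next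
    case right
    then obtain i k where ik: "i \<in> {1..<n}" "k \<in> {1..<n}" "q = ?q i" "p = ?q k"
      using split pqr by metis
    then have "i \<noteq> k" using pqr by auto
    then show ?thesis using angle_base_fan ik right pqr by (metis angle_commute)
  next
    case line
    then obtain i j k where "p = ?q i" "q = ?q j" "r = ?q k"
      using split pqr by metis
    then have "a \<in> {0, pi}" using angle_on_line pqr by metis
    then show ?thesis using a by auto
  qed
qed

lemma num_angles_fan: "num_angles (fan n) \<le> n - 2"
proof -
  have "num_angles (fan n) \<le> card ((\<lambda>m. real m * pi / real n) ` {1..n - 2})"
    unfolding num_angles_def by (intro card_mono angles_fan) auto
  also have "\<dots> \<le> n - 2" using card_image_le[of "{1..n - 2}"] by simp
  finally show ?thesis .
qed

section \<open>Admissibility of the fan\<close>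

lemma not_collinear_fan:
  assumes "n > 2"
  shows "\<not> collinear (fan n)"
proof
  let ?s = "real 1 * pi / real n" and ?t = "real 2 * pi / real n"
  assume "collinear (fan n)"
  then have "collinear {0, line_point ?s, line_point ?t}"
    using assms unfolding fan_def by (elim collinear_subset) (intro insert_mono, auto intro!: imageI simp del: of_nat_1 of_nat_numeral One_nat_def mult_1 of_nat_Suc)
  then obtain c where "line_point ?t = c *\<^sub>R line_point ?s"
    by (auto simp: collinear_lemma)
  then have "line_point ?t $ 1 = c * line_point ?s $ 1" "line_point ?t $ 2 = c * line_point ?s $ 2"
    by (metis vector_scaleR_component real_scaleR_def)+
  \<comment> \<open>Both second coordinates are 1, which forces \<open>c = 1\<close>.\<close>
  then have "cot ?t = cot ?s" by simp
  moreover have "cot ?t < cot ?s"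
    using assms fan_angle_bounds[of 1 n] fan_angle_bounds[of 2 n] fan_angle_less[of 1 2 n]
    by (intro cot_strict_antimono) auto
  ultimately show False by simp
qed

lemma line_sphere_card:
  assumes "T \<subseteq> sphere c r" "T \<subseteq> range line_point"
  shows "card T \<le> 2"
proof (cases "T = {}")
  case False
  then obtain a where a: "a \<in> T" by blast
  \<comment> \<open>The second candidate is the mirror image of \<open>a\<close> in the vertical
    line through the centre \<open>c\<close>.\<close>
  have "x = a \<or> x = vector [2 * c $ 1 - a $ 1, 1]" if "x \<in> T" for x
  proof -
    have two: "x $ 2 = 1" "a $ 2 = 1" using that a assms(2) by auto
    have "norm (c - x) = norm (c - a)"
      using subsetD[OF assms(1) that] subsetD[OF assms(1) a] by (simp add: dist_norm)
    then have "(c $ 1 - x $ 1)\<^sup>2 = (c $ 1 - a $ 1)\<^sup>2"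
      by (simp add: norm_vec_def L2_set_def sum_2 two)
    then have "x $ 1 = a $ 1 \<or> x $ 1 = 2 * c $ 1 - a $ 1"
      by (auto simp: power2_eq_iff)
    then show ?thesis using two by (auto simp: vec_eq_iff forall_2)
  qed
  then have "T \<subseteq> {a, vector [2 * c $ 1 - a $ 1, 1]}" by blast
  then have "card T \<le> card {a, vector [2 * c $ 1 - a $ 1, 1]}" by (intro card_mono) auto
  also have "\<dots> \<le> 2" by (simp add: card_insert_if)
  finally show ?thesis .
qed simp

lemma no_four_concyclic_fan: "no_four_concyclic (fan n)"
  unfolding no_four_concyclic_def concyclic_def
proof safe
  fix S c r assume S: "S \<subseteq> fan n" "card S = 4" "S \<subseteq> sphere c r"
  \<comment> \<open>Without the origin, \<open>S\<close> lies on the line as well as on the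
    circle.\<close>
  then have "card (S - {0}) \<le> 2"
    by (intro line_sphere_card) (auto simp: fan_def)
  moreover have "card S \<le> card (S - {0}) + 1"
    using S by (simp add: card_Diff_singleton_if)
  ultimately show False using S by simp
qed

theorem lemma2p9:
  fixes n :: nat
  assumes "n > 3"
  shows "A_no4c n \<le> enat (n - 2)"
proof -
  have "fan n \<in> no4c_configs n"
    using assms
    by (simp add: no4c_configs_def finite_fan card_fan not_collinear_fan no_four_concyclic_fan)
  then have "A_no4c n \<le> enat (num_angles (fan n))"
    unfolding A_no4c_def by (rule INF_lower)
  also have "\<dots> \<le> enat (n - 2)" by (simp add: num_angles_fan)
  finally show ?thesis .
qed

end
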